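(* For every positive bounded diagonal operator $D$ on $\ell^2$ there exists a positive linear operator $X\colon \ell^2\to L^2[0,1]$ such that $X^*X=D$. Furthermore, there exists a positive self-adjoint operator $Y\colon L^2[0,1]\to L^2[0,1]$ such that $Y^2=XX^*$.
   Context: $\ell^2$ (real sequences, coordinatewise order) and $L^2[0,1]$ (Lebesgue measure, real functions, almost everywhere order) are regarded as Hilbert lattices; $X^*$ denotes the Hilbert space adjoint. A linear operator between vector lattices is positive if it maps the positive cone into the positive cone. A diagonal operator on $\ell^2$ is one that is diagonal with respect to the standard basis; it is positive exactly when its diagonal entries are non-negative. *)

theory Defs
  imports "HOL-Analysis.Analysis"
begin

section \<open>The Hilbert lattice of square-summable real sequences\<close>

lemma square_summable_add:
  fixes x y :: "nat \<Rightarrow> real"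
  assumes "summable (\<lambda>n. (x n)\<^sup>2)" "summable (\<lambda>n. (y n)\<^sup>2)"
  shows "summable (\<lambda>n. (x n + y n)\<^sup>2)"
proof (rule summable_comparison_test')
  show "summable (\<lambda>n. 2 * (x n)\<^sup>2 + 2 * (y n)\<^sup>2)"
    using assms by (intro summable_add summable_mult)
  have "(a + b)\<^sup>2 \<le> 2 * a\<^sup>2 + 2 * b\<^sup>2" for a b :: real
    using zero_le_power2[of "a - b"] by (simp add: power2_sum power2_diff)
  then show "norm ((x n + y n)\<^sup>2) \<le> 2 * (x n)\<^sup>2 + 2 * (y n)\<^sup>2" if "n \<ge> 0" for n
    by simp
qed

lemma square_summable_mult:
  fixes x y :: "nat \<Rightarrow> real"
  assumes "summable (\<lambda>n. (x n)\<^sup>2)" "summable (\<lambda>n. (y n)\<^sup>2)"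
  shows "summable (\<lambda>n. x n * y n)"
proof -
  have "summable (\<lambda>n. ((x n + y n)\<^sup>2 - (x n)\<^sup>2 - (y n)\<^sup>2) / 2)"
    using assms by (intro summable_divide summable_diff square_summable_add)
  then show ?thesis
    by (simp add: power2_sum)
qed

lemma max_square_le: "(max a b)\<^sup>2 \<le> a\<^sup>2 + b\<^sup>2" for a b :: real
  by (simp add: max_def)

lemma min_square_le: "(min a b)\<^sup>2 \<le> a\<^sup>2 + b\<^sup>2" for a b :: real
  by (simp add: min_def)

lemma square_summable_min:
  fixes x y :: "nat \<Rightarrow> real"
  assumes "summable (\<lambda>n. (x n)\<^sup>2)" "summable (\<lambda>n. (y n)\<^sup>2)"
  shows "summable (\<lambda>n. (min (x n) (y n))\<^sup>2)"
  by (rule summable_comparison_test'[OF summable_add[OF assms]]) (simp add: min_square_le)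

lemma square_summable_max:
  fixes x y :: "nat \<Rightarrow> real"
  assumes "summable (\<lambda>n. (x n)\<^sup>2)" "summable (\<lambda>n. (y n)\<^sup>2)"
  shows "summable (\<lambda>n. (max (x n) (y n))\<^sup>2)"
  by (rule summable_comparison_test'[OF summable_add[OF assms]]) (simp add: max_square_le)

typedef ell2 = "{x :: nat \<Rightarrow> real. summable (\<lambda>n. (x n)\<^sup>2)}"
  morphisms ell2_nth Abs_ell2
  by (rule exI[of _ "\<lambda>_. 0"]) simp

setup_lifting type_definition_ell2

instantiation ell2 :: "{real_inner, lattice, ordered_real_vector}"
begin

lift_definition zero_ell2 :: ell2 is "\<lambda>_. 0" by simp

lift_definition plus_ell2 :: "ell2 \<Rightarrow> ell2 \<Rightarrow> ell2" is "\<lambda>x y n. x n + y n"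
  by (rule square_summable_add)

lift_definition uminus_ell2 :: "ell2 \<Rightarrow> ell2" is "\<lambda>x n. - x n" by simp

definition minus_ell2 :: "ell2 \<Rightarrow> ell2 \<Rightarrow> ell2"
  where "minus_ell2 x y = x + - y"

lift_definition scaleR_ell2 :: "real \<Rightarrow> ell2 \<Rightarrow> ell2" is "\<lambda>c x n. c * x n"
  by (simp add: power_mult_distrib summable_mult)

lift_definition inner_ell2 :: "ell2 \<Rightarrow> ell2 \<Rightarrow> real" is "\<lambda>x y. \<Sum>n. x n * y n" .

definition norm_ell2 :: "ell2 \<Rightarrow> real"
  where "norm_ell2 x = sqrt (inner x x)"

definition dist_ell2 :: "ell2 \<Rightarrow> ell2 \<Rightarrow> real"
  where "dist_ell2 x y = norm (x - y)"

definition sgn_ell2 :: "ell2 \<Rightarrow> ell2"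
  where "sgn_ell2 x = inverse (norm x) *\<^sub>R x"

definition uniformity_ell2 :: "(ell2 \<times> ell2) filter"
  where "uniformity_ell2 = (INF e\<in>{0 <..}. principal {(x, y). dist x y < e})"

definition open_ell2 :: "ell2 set \<Rightarrow> bool"
  where "open_ell2 S = (\<forall>x\<in>S. \<forall>\<^sub>F (x', y) in uniformity. x' = x \<longrightarrow> y \<in> S)"

lift_definition less_eq_ell2 :: "ell2 \<Rightarrow> ell2 \<Rightarrow> bool" is "\<lambda>x y. \<forall>n. x n \<le> y n" .

definition less_ell2 :: "ell2 \<Rightarrow> ell2 \<Rightarrow> bool"
  where "less_ell2 x y \<longleftrightarrow> x \<le> y \<and> \<not> y \<le> x"

lift_definition inf_ell2 :: "ell2 \<Rightarrow> ell2 \<Rightarrow> ell2" is "\<lambda>x y n. min (x n) (y n)"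
  by (rule square_summable_min)

lift_definition sup_ell2 :: "ell2 \<Rightarrow> ell2 \<Rightarrow> ell2" is "\<lambda>x y n. max (x n) (y n)"
  by (rule square_summable_max)

instance
proof
  fix x y z :: ell2 and a b :: real
  show "x + y + z = x + (y + z)" "x + y = y + x" "0 + x = x" "- x + x = 0"
    "a *\<^sub>R (x + y) = a *\<^sub>R x + a *\<^sub>R y" "(a + b) *\<^sub>R x = a *\<^sub>R x + b *\<^sub>R x"
    "a *\<^sub>R b *\<^sub>R x = (a * b) *\<^sub>R x" "1 *\<^sub>R x = x"
    by (transfer; simp add: fun_eq_iff algebra_simps)+
  show "x - y = x + - y" by (rule minus_ell2_def)
  show "dist x y = norm (x - y)" by (rule dist_ell2_def)
  show "sgn x = inverse (norm x) *\<^sub>R x" by (rule sgn_ell2_def)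
  show "uniformity = (INF e\<in>{0 <..}. principal {(x, y :: ell2). dist x y < e})"
    by (rule uniformity_ell2_def)
  show "open S = (\<forall>x\<in>S. \<forall>\<^sub>F (x', y) in uniformity. x' = x \<longrightarrow> y \<in> S)" for S :: "ell2 set"
    by (rule open_ell2_def)
  show "inner x y = inner y x"
    by transfer (simp add: mult.commute)
  show "inner (x + y) z = inner x z + inner y z"
    by transfer (simp add: distrib_right suminf_add square_summable_mult)
  show "inner (a *\<^sub>R x) y = a * inner x y"
    by transfer (simp add: mult.assoc suminf_mult square_summable_mult)
  show "0 \<le> inner x x"
    by transfer (auto simp flip: power2_eq_square intro: suminf_nonneg)
  show "inner x x = 0 \<longleftrightarrow> x = 0"
    by transfer (simp add: suminf_eq_zero_iff fun_eq_iff flip: power2_eq_square)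
  show "norm x = sqrt (inner x x)" by (rule norm_ell2_def)
  show "x < y \<longleftrightarrow> x \<le> y \<and> \<not> y \<le> x" by (rule less_ell2_def)
  show "x \<le> x" by transfer simp
  show "x \<le> z" if "x \<le> y" "y \<le> z" using that by transfer (meson order_trans)
  show "x = y" if "x \<le> y" "y \<le> x" using that by transfer (auto simp: fun_eq_iff intro: antisym)
  show "inf x y \<le> x" "inf x y \<le> y" "x \<le> sup x y" "y \<le> sup x y"
    by (transfer; simp)+
  show "x \<le> inf y z" if "x \<le> y" "x \<le> z" using that by transfer simp
  show "sup y z \<le> x" if "y \<le> x" "z \<le> x" using that by transfer simp
  show "z + x \<le> z + y" if "x \<le> y" using that by transfer simp
  show "a *\<^sub>R x \<le> a *\<^sub>R y" if "x \<le> y" "0 \<le> a"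
    using that by transfer (simp add: mult_left_mono)
  show "a *\<^sub>R x \<le> b *\<^sub>R x" if "a \<le> b" "0 \<le> x"
    using that by transfer (simp add: mult_right_mono)
qed

end

lift_definition ell2_basis :: "nat \<Rightarrow> ell2" is "\<lambda>k n. if n = k then 1 else 0"
  by (rule summable_finite[of "{k}" for k]) auto

section \<open>The Hilbert lattice of square-integrable functions on the unit interval\<close>

abbreviation unit_lebesgue :: "real measure"
  where "unit_lebesgue \<equiv> lebesgue_on {0..1}"

definition square_integrable :: "(real \<Rightarrow> real) \<Rightarrow> bool"
  where "square_integrable f \<longleftrightarrow>
    f \<in> borel_measurable unit_lebesgue \<and> integrable unit_lebesgue (\<lambda>t. (f t)\<^sup>2)"

lemma square_integrable_dominated:
  assumes "square_integrable f" "square_integrable g" "h \<in> borel_measurable unit_lebesgue"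
    and "\<And>t. (h t)\<^sup>2 \<le> c * ((f t)\<^sup>2 + (g t)\<^sup>2)"
  shows "square_integrable h"
  unfolding square_integrable_def
proof
  show "integrable unit_lebesgue (\<lambda>t. (h t)\<^sup>2)"
  proof (rule Bochner_Integration.integrable_bound)
    show "integrable unit_lebesgue (\<lambda>t. c * ((f t)\<^sup>2 + (g t)\<^sup>2))"
      using assms(1,2) by (simp add: square_integrable_def)
    show "(\<lambda>t. (h t)\<^sup>2) \<in> borel_measurable unit_lebesgue"
      using assms(3) by measurable
    show "AE t in unit_lebesgue. norm ((h t)\<^sup>2) \<le> norm (c * ((f t)\<^sup>2 + (g t)\<^sup>2))"
    proof (rule AE_I2)
      show "norm ((h t)\<^sup>2) \<le> norm (c * ((f t)\<^sup>2 + (g t)\<^sup>2))" for t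
        using assms(4)[of t] by simp
    qed
  qed
qed (rule assms(3))

lemma square_integrable_measurable:
  "square_integrable f \<Longrightarrow> f \<in> borel_measurable unit_lebesgue"
  by (simp add: square_integrable_def)

lemma square_integrable_zero: "square_integrable (\<lambda>_. 0)"
  by (simp add: square_integrable_def)

lemma square_integrable_add:
  assumes "square_integrable f" "square_integrable g"
  shows "square_integrable (\<lambda>t. f t + g t)"
proof (rule square_integrable_dominated[OF assms, where c = 2])
  show "(f t + g t)\<^sup>2 \<le> 2 * ((f t)\<^sup>2 + (g t)\<^sup>2)" for t
    using zero_le_power2[of "f t - g t"] by (simp add: power2_sum power2_diff)
qed (intro borel_measurable_add square_integrable_measurable assms)

lemma square_integrable_scale:
  assumes "square_integrable f"
  shows "square_integrable (\<lambda>t. c * f t)"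
  using assms by (auto simp: square_integrable_def power_mult_distrib)

lemma square_integrable_uminus:
  assumes "square_integrable f"
  shows "square_integrable (\<lambda>t. - f t)"
  using square_integrable_scale[OF assms, of "-1"] by simp

lemma square_integrable_min:
  assumes "square_integrable f" "square_integrable g"
  shows "square_integrable (\<lambda>t. min (f t) (g t))"
  by (rule square_integrable_dominated[OF assms, where c = 1])
    (intro borel_measurable_min square_integrable_measurable assms, simp add: min_square_le)

lemma square_integrable_max:
  assumes "square_integrable f" "square_integrable g"
  shows "square_integrable (\<lambda>t. max (f t) (g t))"
  by (rule square_integrable_dominated[OF assms, where c = 1])
    (intro borel_measurable_max square_integrable_measurable assms, simp add: max_square_le)

lemma square_integrable_mult:
  assumes "square_integrable f" "square_integrable g"
  shows "integrable unit_lebesgue (\<lambda>t. f t * g t)"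
proof -
  have "integrable unit_lebesgue (\<lambda>t. ((f t + g t)\<^sup>2 - (f t)\<^sup>2 - (g t)\<^sup>2) / 2)"
    using assms square_integrable_add[OF assms] by (simp add: square_integrable_def)
  then show ?thesis
    by (simp add: power2_sum)
qed

definition L2_rel :: "(real \<Rightarrow> real) \<Rightarrow> (real \<Rightarrow> real) \<Rightarrow> bool"
  where "L2_rel f g \<longleftrightarrow>
    square_integrable f \<and> square_integrable g \<and> (AE t in unit_lebesgue. f t = g t)"

lemma part_equivp_L2_rel: "part_equivp L2_rel"
proof (rule part_equivpI)
  show "\<exists>f. L2_rel f f"
    using square_integrable_zero by (auto simp: L2_rel_def)
  show "symp L2_rel"
    by (auto simp: symp_def L2_rel_def)
  show "transp L2_rel"
    unfolding transp_def L2_rel_def by (auto elim: AE_mp)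
qed

quotient_type L2_unit = "real \<Rightarrow> real" / partial: L2_rel
  by (rule part_equivp_L2_rel)

instantiation L2_unit :: "{real_inner, lattice, ordered_real_vector}"
begin

lift_definition zero_L2_unit :: L2_unit is "\<lambda>_. 0"
  by (simp add: L2_rel_def square_integrable_zero)

lift_definition plus_L2_unit :: "L2_unit \<Rightarrow> L2_unit \<Rightarrow> L2_unit" is "\<lambda>f g t. f t + g t"
  by (auto simp: L2_rel_def square_integrable_add)

lift_definition uminus_L2_unit :: "L2_unit \<Rightarrow> L2_unit" is "\<lambda>f t. - f t"
  by (auto simp: L2_rel_def square_integrable_uminus)

definition minus_L2_unit :: "L2_unit \<Rightarrow> L2_unit \<Rightarrow> L2_unit"
  where "minus_L2_unit f g = f + - g"

lift_definition scaleR_L2_unit :: "real \<Rightarrow> L2_unit \<Rightarrow> L2_unit" is "\<lambda>c f t. c * f t"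
  by (auto simp: L2_rel_def square_integrable_scale)

lift_definition inner_L2_unit :: "L2_unit \<Rightarrow> L2_unit \<Rightarrow> real"
  is "\<lambda>f g. \<integral>t. f t * g t \<partial>unit_lebesgue"
  by (rule integral_cong_AE)
    (auto simp: L2_rel_def intro!: borel_measurable_times dest: square_integrable_measurable)

definition norm_L2_unit :: "L2_unit \<Rightarrow> real"
  where "norm_L2_unit f = sqrt (inner f f)"

definition dist_L2_unit :: "L2_unit \<Rightarrow> L2_unit \<Rightarrow> real"
  where "dist_L2_unit f g = norm (f - g)"

definition sgn_L2_unit :: "L2_unit \<Rightarrow> L2_unit"
  where "sgn_L2_unit f = inverse (norm f) *\<^sub>R f"

definition uniformity_L2_unit :: "(L2_unit \<times> L2_unit) filter"
  where "uniformity_L2_unit = (INF e\<in>{0 <..}. principal {(f, g). dist f g < e})"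

definition open_L2_unit :: "L2_unit set \<Rightarrow> bool"
  where "open_L2_unit S = (\<forall>f\<in>S. \<forall>\<^sub>F (f', g) in uniformity. f' = f \<longrightarrow> g \<in> S)"

lift_definition less_eq_L2_unit :: "L2_unit \<Rightarrow> L2_unit \<Rightarrow> bool"
  is "\<lambda>f g. AE t in unit_lebesgue. f t \<le> g t"
proof -
  fix f f' g g' assume "L2_rel f f'" "L2_rel g g'"
  then have "AE t in unit_lebesgue. f t = f' t" "AE t in unit_lebesgue. g t = g' t"
    by (auto simp: L2_rel_def)
  then have "AE t in unit_lebesgue. f t \<le> g t \<longleftrightarrow> f' t \<le> g' t"
    by eventually_elim simp
  then show "(AE t in unit_lebesgue. f t \<le> g t) = (AE t in unit_lebesgue. f' t \<le> g' t)"
    by (rule eventually_subst)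
qed

definition less_L2_unit :: "L2_unit \<Rightarrow> L2_unit \<Rightarrow> bool"
  where "less_L2_unit f g \<longleftrightarrow> f \<le> g \<and> \<not> g \<le> f"

lift_definition inf_L2_unit :: "L2_unit \<Rightarrow> L2_unit \<Rightarrow> L2_unit" is "\<lambda>f g t. min (f t) (g t)"
  by (auto simp: L2_rel_def square_integrable_min)

lift_definition sup_L2_unit :: "L2_unit \<Rightarrow> L2_unit \<Rightarrow> L2_unit" is "\<lambda>f g t. max (f t) (g t)"
  by (auto simp: L2_rel_def square_integrable_max)

instance
proof
  fix f g h :: L2_unit and a b :: real
  show "f + g + h = f + (g + h)" "f + g = g + f" "0 + f = f" "- f + f = 0"
    "a *\<^sub>R (f + g) = a *\<^sub>R f + a *\<^sub>R g" "(a + b) *\<^sub>R f = a *\<^sub>R f + b *\<^sub>R f"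
    "a *\<^sub>R b *\<^sub>R f = (a * b) *\<^sub>R f" "1 *\<^sub>R f = f"
    by (transfer; simp add: L2_rel_def square_integrable_add square_integrable_scale
        square_integrable_zero algebra_simps)+
  show "f - g = f + - g" by (rule minus_L2_unit_def)
  show "dist f g = norm (f - g)" by (rule dist_L2_unit_def)
  show "sgn f = inverse (norm f) *\<^sub>R f" by (rule sgn_L2_unit_def)
  show "uniformity = (INF e\<in>{0 <..}. principal {(f, g :: L2_unit). dist f g < e})"
    by (rule uniformity_L2_unit_def)
  show "open S = (\<forall>f\<in>S. \<forall>\<^sub>F (f', g) in uniformity. f' = f \<longrightarrow> g \<in> S)" for S :: "L2_unit set"
    by (rule open_L2_unit_def)
  show "inner f g = inner g f"
    by transfer (simp add: mult.commute)
  show "inner (f + g) h = inner f h + inner g h"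
    by transfer (simp add: L2_rel_def distrib_right square_integrable_mult)
  show "inner (a *\<^sub>R f) g = a * inner f g"
    by transfer (simp add: mult.assoc)
  show "0 \<le> inner f f"
    by transfer simp
  show "inner f f = 0 \<longleftrightarrow> f = 0"
  proof transfer
    fix f :: "real \<Rightarrow> real" assume "L2_rel f f"
    then have "square_integrable f" by (simp add: L2_rel_def)
    then have "(\<integral>t. f t * f t \<partial>unit_lebesgue) = 0 \<longleftrightarrow> (AE t in unit_lebesgue. f t * f t = 0)"
      by (intro integral_nonneg_eq_0_iff_AE square_integrable_mult) auto
    then show "(\<integral>t. f t * f t \<partial>unit_lebesgue) = 0 \<longleftrightarrow> L2_rel f (\<lambda>_. 0)"
      using \<open>square_integrable f\<close> by (simp add: L2_rel_def square_integrable_zero)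
  qed
  show "norm f = sqrt (inner f f)" by (rule norm_L2_unit_def)
  show "f < g \<longleftrightarrow> f \<le> g \<and> \<not> g \<le> f" by (rule less_L2_unit_def)
  show "f \<le> f" by transfer simp
  show "f \<le> h" if "f \<le> g" "g \<le> h" using that by transfer (auto elim: AE_mp)
  show "f = g" if "f \<le> g" "g \<le> f"
    using that by transfer (auto simp: L2_rel_def elim: AE_mp)
  show "inf f g \<le> f" "inf f g \<le> g" "f \<le> sup f g" "g \<le> sup f g"
    by (transfer; simp)+
  show "f \<le> inf g h" if "f \<le> g" "f \<le> h" using that by transfer auto
  show "sup g h \<le> f" if "g \<le> f" "h \<le> f" using that by transfer auto
  show "h + f \<le> h + g" if "f \<le> g" using that by transfer simp
  show "a *\<^sub>R f \<le> a *\<^sub>R g" if "f \<le> g" "0 \<le> a"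
    using that by transfer (auto elim!: eventually_mono simp: mult_left_mono)
  show "a *\<^sub>R f \<le> b *\<^sub>R f" if "a \<le> b" "0 \<le> f"
    using that by transfer (auto elim!: eventually_mono simp: mult_right_mono)
qed

end

section \<open>Operators\<close>

definition positive_operator ::
    "('a :: {lattice, ordered_real_vector} \<Rightarrow> 'b :: {lattice, ordered_real_vector}) \<Rightarrow> bool"
  where "positive_operator T \<longleftrightarrow> linear T \<and> (\<forall>x. 0 \<le> x \<longrightarrow> 0 \<le> T x)"

text \<open>
  The condition on basis vectors determines all of \<open>D\<close> only when \<open>D\<close> is bounded, which has to be
  assumed separately.
\<close>

definition diagonal_operator :: "(ell2 \<Rightarrow> ell2) \<Rightarrow> bool"
  where "diagonal_operator D \<longleftrightarrow>
    (\<exists>d :: nat \<Rightarrow> real. \<forall>n. D (ell2_basis n) = d n *\<^sub>R ell2_basis n)"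

text \<open>
  The library's \<^const>\<open>adjoint\<close> is a Hilbert choice, hence meaningful only for operators that have an
  adjoint; bounded operators between Hilbert spaces do, so it is used together with
  \<^const>\<open>bounded_linear\<close>.
\<close>

definition self_adjoint :: "('a :: real_inner \<Rightarrow> 'a) \<Rightarrow> bool"
  where "self_adjoint T \<longleftrightarrow> bounded_linear T \<and> adjoint T = T"

end

theory Submission
  imports Defs
begin

text \<open>
  The unit interval splits into countably many disjoint pieces of positive measure, so the normalized
  indicator functions of the pieces form an orthonormal sequence of \<^emph>\<open>positive\<close> elements of
  \<open>L\<^sup>2[0,1]\<close>. Sending the standard basis of \<open>l\<^sup>2\<close> to that sequence gives an isometry \<open>S\<close> which is
  positive (\<open>step_embedding\<close>). Its adjoint \<open>S\<^sup>*\<close> is positive as well, because its coordinates are inner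
  products with positive functions (\<open>adjoint_nonneg\<close>), and \<open>S\<^sup>* S\<close> is the identity
  (\<open>ell2_adjoint_isometry\<close>).

  A positive bounded diagonal operator \<open>D\<close> has a positive self-adjoint square root \<open>R\<close>, the diagonal
  operator of the roots of its entries (\<open>positive_diagonal_sqrt\<close>). Put \<open>X = S R\<close> and
  \<open>Y = S R S\<^sup>*\<close>. Both are positive, \<open>Y\<close> is self-adjoint, and cancelling \<open>S\<^sup>* S\<close> in the middle gives
  \<open>X\<^sup>* X = R S\<^sup>* S R = R\<^sup>2 = D\<close> and \<open>Y\<^sup>2 = S R S\<^sup>* S R S\<^sup>* = S R R S\<^sup>* = X X\<^sup>*\<close>.

  The space \<open>l\<^sup>2\<close> is handled through coordinates: finite truncations of a sequence converge to it, which
  shows that a bounded operator is determined by its values on the basis and that it has an adjoint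
  (\<open>ell2_adjoint_works\<close>).
\<close>

section \<open>Bounded operators on the sequence space\<close>

lemma ell2_inner_eq: "inner x y = (\<Sum>n. ell2_nth x n * ell2_nth y n)"
  by transfer simp

lemma summable_ell2: "summable (\<lambda>n. ell2_nth x n * ell2_nth y n)"
  by transfer (rule square_summable_mult)

lemma ell2_nth_add: "ell2_nth (x + y) n = ell2_nth x n + ell2_nth y n"
  by transfer simp

lemma ell2_nth_scaleR: "ell2_nth (c *\<^sub>R x) n = c * ell2_nth x n"
  by transfer simp

lemma ell2_nth_diff: "ell2_nth (x - y) n = ell2_nth x n - ell2_nth y n"
  unfolding diff_conv_add_uminus by transfer simp

lemma ell2_nth_sum: "ell2_nth (\<Sum>i\<in>A. f i) n = (\<Sum>i\<in>A. ell2_nth (f i) n)"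
proof (induction A rule: infinite_finite_induct)
  case (insert a A)
  then show ?case by (simp add: ell2_nth_add)
qed (simp_all add: zero_ell2.rep_eq)

lemma ell2_nth_basis: "ell2_nth (ell2_basis k) n = (if n = k then 1 else 0)"
  by transfer simp

lemma ell2_eqI: "(\<And>n. ell2_nth x n = ell2_nth y n) \<Longrightarrow> x = y"
  by transfer auto

lemma inner_basis: "inner (ell2_basis n) x = ell2_nth x n"
proof -
  have "(\<lambda>m. ell2_nth (ell2_basis n) m * ell2_nth x m)
      sums (\<Sum>m\<in>{n}. ell2_nth (ell2_basis n) m * ell2_nth x m)"
    by (rule sums_finite) (auto simp: ell2_nth_basis)
  then show ?thesis
    by (simp add: ell2_inner_eq ell2_nth_basis sums_iff)
qed

lemma norm_basis: "norm (ell2_basis n) = 1"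
  by (simp add: norm_eq_sqrt_inner inner_basis ell2_nth_basis)

lemma basis_nonneg: "0 \<le> ell2_basis n"
  by transfer simp

lemma ell2_nth_basis_sum:
  "ell2_nth (\<Sum>k<N. a k *\<^sub>R ell2_basis k) n = (if n < N then a n else 0)"
  by (simp add: ell2_nth_sum ell2_nth_scaleR ell2_nth_basis if_distrib [where f = "\<lambda>c. _ * c"]
      cong: if_cong)

definition ell2_truncate :: "nat \<Rightarrow> ell2 \<Rightarrow> ell2"
  where "ell2_truncate N x = (\<Sum>n<N. ell2_nth x n *\<^sub>R ell2_basis n)"

lemma ell2_nth_truncate: "ell2_nth (ell2_truncate N x) n = (if n < N then ell2_nth x n else 0)"
  by (simp add: ell2_truncate_def ell2_nth_basis_sum)

lemma ell2_truncate_tendsto: "(\<lambda>N. ell2_truncate N x) \<longlonglongrightarrow> x"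
proof -
  have eq: "(norm (ell2_truncate N x - x))\<^sup>2 = (\<Sum>n. (ell2_nth x (n + N))\<^sup>2)" for N
  proof -
    have "(norm (ell2_truncate N x - x))\<^sup>2
        = (\<Sum>n. ell2_nth (ell2_truncate N x - x) n * ell2_nth (ell2_truncate N x - x) n)"
      by (simp add: power2_norm_eq_inner ell2_inner_eq)
    also have "\<dots> = (\<Sum>n. ell2_nth (ell2_truncate N x - x) (n + N)
        * ell2_nth (ell2_truncate N x - x) (n + N))"
      by (subst suminf_split_initial_segment[OF summable_ell2, of _ _ N])
        (simp add: ell2_nth_diff ell2_nth_truncate)
    finally show ?thesis
      by (simp add: ell2_nth_diff ell2_nth_truncate power2_eq_square)
  qed
  have "summable (\<lambda>n. (ell2_nth x n)\<^sup>2)"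
    using summable_ell2[of x x] by (simp add: power2_eq_square)
  then have "(\<lambda>N. sqrt (\<Sum>n. (ell2_nth x (n + N))\<^sup>2)) \<longlonglongrightarrow> sqrt 0"
    by (intro tendsto_real_sqrt suminf_exist_split2)
  then have "(\<lambda>N. norm (ell2_truncate N x - x)) \<longlonglongrightarrow> 0"
    by (simp flip: eq)
  then show ?thesis
    by (rule LIM_zero_cancel[OF tendsto_norm_zero_cancel])
qed

lemma bounded_linear_truncate:
  assumes "bounded_linear T"
  shows "T (ell2_truncate N x) = (\<Sum>n<N. ell2_nth x n *\<^sub>R T (ell2_basis n))"
  using bounded_linear.linear[OF assms] by (simp add: ell2_truncate_def linear_sum linear_cmul)

lemma bounded_linear_eq_on_basis:
  fixes S T :: "ell2 \<Rightarrow> 'a::real_normed_vector"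
  assumes "bounded_linear S" "bounded_linear T"
    and "\<And>n. S (ell2_basis n) = T (ell2_basis n)"
  shows "S = T"
proof
  fix x
  have "(\<lambda>N. S (ell2_truncate N x)) \<longlonglongrightarrow> S x"
    by (rule bounded_linear.tendsto[OF assms(1) ell2_truncate_tendsto])
  moreover have "(\<lambda>N. T (ell2_truncate N x)) \<longlonglongrightarrow> T x"
    by (rule bounded_linear.tendsto[OF assms(2) ell2_truncate_tendsto])
  moreover have "S (ell2_truncate N x) = T (ell2_truncate N x)" for N
    by (simp only: bounded_linear_truncate[OF assms(1)] bounded_linear_truncate[OF assms(2)] assms(3))
  ultimately show "S x = T x"
    by (simp only: LIMSEQ_unique)
qed

text \<open>
  Bessel-type estimate: testing the bound for \<open>T\<close> on the finite sequence \<open>u\<close> of the first \<open>N\<close>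
  coefficients \<open>a n = \<langle>T e\<^sub>n, f\<rangle>\<close> gives \<open>\<parallel>u\<parallel>\<^sup>2 = \<langle>T u, f\<rangle> \<le> B \<parallel>u\<parallel> \<parallel>f\<parallel>\<close>, hence \<open>\<parallel>u\<parallel> \<le> B \<parallel>f\<parallel>\<close> for every \<open>N\<close>.
\<close>

lemma square_summable_coefficients:
  fixes T :: "ell2 \<Rightarrow> 'a::real_inner"
  assumes T: "bounded_linear T"
  shows "summable (\<lambda>n. (inner (T (ell2_basis n)) f)\<^sup>2)"
proof -
  define a where "a n = inner (T (ell2_basis n)) f" for n
  obtain B where "0 < B" and B: "\<And>x. norm (T x) \<le> norm x * B"
    using bounded_linear.pos_bounded[OF T] by blast
  have "(\<Sum>n<N. (a n)\<^sup>2) \<le> (B * norm f)\<^sup>2" for N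
  proof -
    define u where "u = (\<Sum>n<N. a n *\<^sub>R ell2_basis n)"
    have "inner u u = (\<Sum>n<N. a n * inner (ell2_basis n) u)"
      by (subst (1) u_def) (simp add: inner_sum_left)
    also have "\<dots> = (\<Sum>n<N. (a n)\<^sup>2)"
      by (simp add: inner_basis u_def ell2_nth_basis_sum power2_eq_square)
    finally have norm_u: "(\<Sum>n<N. (a n)\<^sup>2) = (norm u)\<^sup>2"
      by (simp add: power2_norm_eq_inner)
    have "T u = (\<Sum>n<N. a n *\<^sub>R T (ell2_basis n))"
      using bounded_linear.linear[OF T] by (simp add: u_def linear_sum linear_cmul)
    then have "inner (T u) f = (\<Sum>n<N. (a n)\<^sup>2)"
      by (simp add: inner_sum_left a_def power2_eq_square)
    then have "(norm u)\<^sup>2 = inner (T u) f"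
      by (simp only: norm_u)
    also have "\<dots> \<le> norm (T u) * norm f"
      by (rule norm_cauchy_schwarz)
    also have "\<dots> \<le> norm u * B * norm f"
      by (intro mult_right_mono B) simp
    finally have le: "norm u * norm u \<le> norm u * (B * norm f)"
      by (simp add: power2_eq_square mult.assoc)
    have "norm u \<le> B * norm f"
    proof (cases "u = 0")
      case False
      then show ?thesis
        using mult_left_le_imp_le[OF le] by simp
    qed (use \<open>0 < B\<close> in simp)
    then show ?thesis
      unfolding norm_u by (rule power_mono) simp
  qed
  then show ?thesis
    unfolding a_def by (intro summableI_nonneg_bounded) auto
qed

text \<open>
  The adjoint can be written down in coordinates, which avoids the Riesz representation theorem:
  \<open>T\<^sup>* f\<close> is the sequence of coefficients \<open>\<langle>T e\<^sub>n, f\<rangle>\<close>.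
\<close>

lemma ell2_adjoint_works:
  fixes T :: "ell2 \<Rightarrow> 'a::real_inner"
  assumes T: "bounded_linear T"
  shows "inner (T x) f = inner x (adjoint T f)"
proof -
  define T' where "T' f = Abs_ell2 (\<lambda>n. inner (T (ell2_basis n)) f)" for f
  have T': "ell2_nth (T' f) n = inner (T (ell2_basis n)) f" for f n
    by (simp add: T'_def Abs_ell2_inverse square_summable_coefficients[OF T])
  have "(\<lambda>x. inner (T x) f) = (\<lambda>x. inner x (T' f))" for f
    by (rule bounded_linear_eq_on_basis)
      (simp_all add: bounded_linear_inner_left_comp T bounded_linear_inner_left inner_basis T')
  then have adj: "inner (T x) f = inner x (T' f)" for x f
    by metis
  then have "adjoint T = T'"
    by (intro adjoint_unique) blast
  with adj show ?thesis by simp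
qed

text \<open>
  The bound \<open>B\<close> for \<open>T\<close> also bounds the adjoint, since
  \<open>\<parallel>T\<^sup>* f\<parallel>\<^sup>2 = \<langle>T T\<^sup>* f, f\<rangle> \<le> B \<parallel>T\<^sup>* f\<parallel> \<parallel>f\<parallel>\<close>.
\<close>

lemma ell2_adjoint_bounded_linear:
  fixes T :: "ell2 \<Rightarrow> 'a::real_inner"
  assumes T: "bounded_linear T"
  shows "bounded_linear (adjoint T)"
proof -
  note adj = ell2_adjoint_works[OF T, symmetric]
  obtain B where "0 < B" and B: "\<And>x. norm (T x) \<le> norm x * B"
    using bounded_linear.pos_bounded[OF T] by blast
  have le: "norm (adjoint T f) \<le> norm f * B" for f
  proof -
    let ?y = "adjoint T f"
    have "norm ?y * norm ?y = inner (T ?y) f"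
      by (metis adj power2_norm_eq_inner power2_eq_square)
    also have "\<dots> \<le> norm (T ?y) * norm f"
      by (rule norm_cauchy_schwarz)
    also have "\<dots> \<le> norm ?y * B * norm f"
      by (intro mult_right_mono B) simp
    finally have *: "norm ?y * norm ?y \<le> norm ?y * (norm f * B)"
      by (simp add: mult_ac)
    show ?thesis
    proof (cases "?y = 0")
      case False
      then show ?thesis using mult_left_le_imp_le[OF *] by simp
    qed (use \<open>0 < B\<close> in simp)
  qed
  show ?thesis
  proof (rule bounded_linear_intro[OF _ _ le])
    show "adjoint T (f + g) = adjoint T f + adjoint T g" for f g
      by (rule vector_eq_ldot[THEN iffD1]) (simp add: adj inner_add_right)
    show "adjoint T (c *\<^sub>R f) = c *\<^sub>R adjoint T f" for c f
      by (rule vector_eq_ldot[THEN iffD1]) (simp add: adj)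
  qed
qed

lemma ell2_adjoint_isometry:
  fixes T :: "ell2 \<Rightarrow> 'a::real_inner"
  assumes T: "bounded_linear T" and iso: "\<And>x y. inner (T x) (T y) = inner x y"
  shows "adjoint T (T y) = y"
  by (rule vector_eq_ldot[THEN iffD1]) (simp add: ell2_adjoint_works[OF T, symmetric] iso)

lemma ex_diagonal_operator:
  assumes "\<And>n. \<bar>c n\<bar> \<le> B"
  shows "\<exists>R. bounded_linear R \<and> (\<forall>x n. ell2_nth (R x) n = c n * ell2_nth x n)"
proof -
  define R where "R x = Abs_ell2 (\<lambda>n. c n * ell2_nth x n)" for x
  have sq: "(c n * y)\<^sup>2 \<le> B\<^sup>2 * y\<^sup>2" for n y
    using assms[of n] by (simp add: power_mult_distrib mult_right_mono abs_le_square_iff[symmetric])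
  have summ: "summable (\<lambda>n. B\<^sup>2 * (ell2_nth x n)\<^sup>2)" for x
    using summable_ell2[of x x] by (simp add: power2_eq_square summable_mult)
  have "summable (\<lambda>n. (c n * ell2_nth x n)\<^sup>2)" for x
    by (rule summable_comparison_test'[OF summ]) (use sq in simp)
  then have R: "ell2_nth (R x) n = c n * ell2_nth x n" for x n
    by (simp add: R_def Abs_ell2_inverse)
  have B0: "0 \<le> B"
    using assms[of 0] by linarith
  have "bounded_linear R"
  proof (rule bounded_linear_intro)
    show "R (x + y) = R x + R y" "R (r *\<^sub>R x) = r *\<^sub>R R x" for r x y
      by (rule ell2_eqI, simp add: R ell2_nth_add ell2_nth_scaleR algebra_simps)+
    show "norm (R x) \<le> norm x * B" for x
    proof (rule power2_le_imp_le)
      have "(norm (R x))\<^sup>2 = (\<Sum>n. (c n * ell2_nth x n)\<^sup>2)"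
        by (simp only: power2_norm_eq_inner ell2_inner_eq R) (simp add: power2_eq_square)
      also have "\<dots> \<le> (\<Sum>n. B\<^sup>2 * (ell2_nth x n)\<^sup>2)"
        by (rule suminf_le[OF sq])
          (use summable_ell2[of "R x" "R x"] summ R in \<open>auto simp: power2_eq_square\<close>)
      also have "\<dots> = (norm x * B)\<^sup>2"
        using suminf_mult[OF summable_ell2[of x x], of "B\<^sup>2"]
        by (simp only: power_mult_distrib power2_norm_eq_inner ell2_inner_eq)
          (simp add: power2_eq_square mult_ac)
      finally show "(norm (R x))\<^sup>2 \<le> (norm x * B)\<^sup>2" .
    qed (simp add: B0)
  qed
  with R show ?thesis by blast
qed

section \<open>Embedding sequences as step functions\<close>

text \<open>
  The pieces of the unit interval are the fibres of \<open>slot\<close>: the integer part of \<open>1 / t\<close> equals \<open>n + 1\<close>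
  exactly on the interval from \<open>1 / (n + 2)\<close> (excluded) to \<open>1 / (n + 1)\<close> (included), whence the shift
  by one. At \<open>t = 0\<close>, where \<open>1 / t = 0\<close>, truncated subtraction adds one more point to the first piece.
\<close>

definition slot :: "real \<Rightarrow> nat"
  where "slot t = nat \<lfloor>1 / t\<rfloor> - 1"

lemma slot_measurable [measurable]: "slot \<in> measurable unit_lebesgue (count_space UNIV)"
proof -
  have "slot \<in> measurable borel (count_space UNIV)"
    unfolding slot_def by measurable
  then show ?thesis
    by (intro measurable_restrict_space1 measurable_completion) simp
qed

definition slot_width :: "nat \<Rightarrow> real"
  where "slot_width n = measure unit_lebesgue (slot -` {n} \<inter> {0..1})"

lemma slot_fibre_sets: "slot -` {n} \<inter> {0..1} \<in> sets unit_lebesgue"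
  using measurable_sets[OF slot_measurable, of "{n}"] by simp

lemma finite_measure_unit: "finite_measure unit_lebesgue"
  by (rule finite_measureI) (simp add: emeasure_restrict_space)

lemma slot_width_pos: "0 < slot_width n"
proof -
  interpret finite_measure unit_lebesgue by (rule finite_measure_unit)
  let ?I = "{1 / (real n + 2)<..1 / (real n + 1)}"
  have "1 / (real n + 2) < 1 / (real n + 1)"
    by (simp add: field_simps)
  moreover have sub: "?I \<subseteq> {0..1}"
  proof
    fix t assume "t \<in> ?I"
    then have "1 / (real n + 2) < t" "t \<le> 1 / (real n + 1)" by auto
    moreover have "0 < 1 / (real n + 2)" "1 / (real n + 1) \<le> 1" by simp_all
    ultimately show "t \<in> {0..1}" unfolding atLeastAtMost_iff by linarith
  qed
  ultimately have "0 < measure unit_lebesgue ?I"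
    by (simp add: measure_restrict_space)
  also have "\<dots> \<le> slot_width n"
    unfolding slot_width_def
  proof (rule finite_measure_mono[OF _ slot_fibre_sets])
    show "?I \<subseteq> slot -` {n} \<inter> {0..1}"
    proof
      fix t assume t: "t \<in> ?I"
      have "0 < 1 / (real n + 2)" by simp
      with t have "0 < t" by (meson greaterThanAtMost_iff less_trans)
      with t have "real n + 1 \<le> 1 / t" "1 / t < real n + 2"
        by (auto simp: field_simps)
      then have "\<lfloor>1 / t\<rfloor> = int n + 1"
        by (intro floor_unique) auto
      then show "t \<in> slot -` {n} \<inter> {0..1}"
        using t sub by (auto simp: slot_def)
    qed
  qed
  finally show ?thesis .
qed

text \<open>
  Integrals of functions that are constant on the pieces are sums: the image of Lebesgue measure under
  \<open>slot\<close> is counting measure weighted by the widths of the pieces.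
\<close>

lemma distr_slot:
  "distr unit_lebesgue (count_space UNIV) slot = density (count_space UNIV) (\<lambda>n. ennreal (slot_width n))"
proof (rule measure_eqI_countable[where A = UNIV])
  interpret finite_measure unit_lebesgue by (rule finite_measure_unit)
  show "emeasure (distr unit_lebesgue (count_space UNIV) slot) {n}
      = emeasure (density (count_space UNIV) (\<lambda>n. ennreal (slot_width n))) {n}" for n
    by (simp add: emeasure_distr emeasure_density slot_width_def emeasure_eq_measure
        nn_integral_count_space_indicator[symmetric] nn_integral_count_space_finite)
qed auto

lemma slot_integral:
  assumes "summable (\<lambda>n. \<bar>a n\<bar>)"
  shows "integrable unit_lebesgue (\<lambda>t. a (slot t) / slot_width (slot t))"
    and "(\<integral>t. a (slot t) / slot_width (slot t) \<partial>unit_lebesgue) = (\<Sum>n. a n)"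
proof -
  have eq: "slot_width n *\<^sub>R (a n / slot_width n) = a n" for n
    using slot_width_pos[of n] by simp
  have nonneg: "AE n in count_space UNIV. 0 \<le> slot_width n"
    using slot_width_pos by (simp add: less_imp_le)
  have int: "integrable (count_space UNIV) a"
    using assms by (simp add: integrable_count_space_nat_iff)
  have "integrable (density (count_space UNIV) (\<lambda>n. ennreal (slot_width n))) (\<lambda>n. a n / slot_width n)"
    using int nonneg
    by (subst integrable_density)
      (simp_all only: eq measurable_count_space_eq1 Pi_UNIV UNIV_I space_borel)
  then show "integrable unit_lebesgue (\<lambda>t. a (slot t) / slot_width (slot t))"
    by (simp add: integrable_distr_eq flip: distr_slot)
  have "(\<integral>t. a (slot t) / slot_width (slot t) \<partial>unit_lebesgue)
      = (\<integral>n. a n / slot_width n \<partial>distr unit_lebesgue (count_space UNIV) slot)"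
    by (simp add: integral_distr)
  also have "\<dots> = (\<integral>n. a n \<partial>count_space UNIV)"
    unfolding distr_slot using nonneg
    by (subst integral_density)
      (simp_all only: eq measurable_count_space_eq1 Pi_UNIV UNIV_I space_borel)
  also have "\<dots> = (\<Sum>n. a n)"
    by (rule integral_count_space_nat[OF int])
  finally show "(\<integral>t. a (slot t) / slot_width (slot t) \<partial>unit_lebesgue) = (\<Sum>n. a n)" .
qed

lemma step_mult:
  "(x / sqrt (slot_width n)) * (y / sqrt (slot_width n)) = x * y / slot_width n"
  using slot_width_pos[of n] by simp

lemma step_square_integrable:
  assumes "summable (\<lambda>n. (x n)\<^sup>2)"
  shows "square_integrable (\<lambda>t. x (slot t) / sqrt (slot_width (slot t)))"
  unfolding square_integrable_def
proof
  show "(\<lambda>t. x (slot t) / sqrt (slot_width (slot t))) \<in> borel_measurable unit_lebesgue"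
    by (rule measurable_compose[OF slot_measurable]) simp
  show "integrable unit_lebesgue (\<lambda>t. (x (slot t) / sqrt (slot_width (slot t)))\<^sup>2)"
    unfolding power2_eq_square step_mult
    by (rule slot_integral(1)) (use assms in \<open>simp add: power2_eq_square\<close>)
qed

text \<open>
  Dividing by the square root of the width makes the step functions on single pieces unit vectors, so
  that the standard basis is mapped to an orthonormal sequence.
\<close>

lift_definition step_embedding :: "ell2 \<Rightarrow> L2_unit"
  is "\<lambda>x t. x (slot t) / sqrt (slot_width (slot t))"
  by (simp add: L2_rel_def step_square_integrable)

lemma step_embedding_inner: "inner (step_embedding x) (step_embedding y) = inner x y"
proof transfer
  fix x y :: "nat \<Rightarrow> real"
  assume "summable (\<lambda>n. (x n)\<^sup>2)" "summable (\<lambda>n. (y n)\<^sup>2)"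
  then have "summable (\<lambda>n. \<bar>x n * y n\<bar>)"
    using square_summable_mult[of "\<lambda>n. \<bar>x n\<bar>" "\<lambda>n. \<bar>y n\<bar>"] by (simp add: abs_mult)
  then show "(\<integral>t. x (slot t) / sqrt (slot_width (slot t)) * (y (slot t) / sqrt (slot_width (slot t)))
      \<partial>unit_lebesgue) = (\<Sum>n. x n * y n)"
    using slot_integral(2)[of "\<lambda>n. x n * y n"] by (simp only: step_mult)
qed

lemma step_embedding_bounded_linear: "bounded_linear step_embedding"
proof (rule bounded_linear_intro)
  show "step_embedding (x + y) = step_embedding x + step_embedding y" for x y
    by transfer (simp add: L2_rel_def add_divide_distrib square_integrable_add
        step_square_integrable)
  show "step_embedding (c *\<^sub>R x) = c *\<^sub>R step_embedding x" for c x
    by transfer (simp add: L2_rel_def step_square_integrable square_integrable_scale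
        flip: times_divide_eq_right)
  show "norm (step_embedding x) \<le> norm x * 1" for x
    by (simp add: norm_eq_sqrt_inner step_embedding_inner)
qed

lemma step_embedding_nonneg: "0 \<le> x \<Longrightarrow> 0 \<le> step_embedding x"
  by transfer (simp add: less_imp_le[OF slot_width_pos])

lemma L2_inner_nonneg:
  fixes f g :: L2_unit
  assumes "0 \<le> f" "0 \<le> g"
  shows "0 \<le> inner f g"
  using assms
proof transfer
  fix f g :: "real \<Rightarrow> real"
  assume "AE t in unit_lebesgue. 0 \<le> f t" "AE t in unit_lebesgue. 0 \<le> g t"
  then have "AE t in unit_lebesgue. 0 \<le> f t * g t"
    by eventually_elim simp
  then show "0 \<le> (\<integral>t. f t * g t \<partial>unit_lebesgue)"
    by (rule integral_nonneg_AE)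
qed

text \<open>
  In \<open>l\<^sup>2\<close> positivity is tested on the basis vectors, which are positive, and
  \<open>\<langle>e\<^sub>n, T\<^sup>* f\<rangle> = \<langle>T e\<^sub>n, f\<rangle>\<close> is an inner product of positive functions.
\<close>

lemma adjoint_nonneg:
  fixes T :: "ell2 \<Rightarrow> L2_unit"
  assumes T: "bounded_linear T" and pos: "\<And>x. 0 \<le> x \<Longrightarrow> 0 \<le> T x" and "0 \<le> f"
  shows "0 \<le> adjoint T f"
proof -
  have "0 \<le> ell2_nth (adjoint T f) n" for n
  proof -
    have "0 \<le> inner (T (ell2_basis n)) f"
      by (intro L2_inner_nonneg pos basis_nonneg assms(3))
    then show ?thesis
      by (simp add: ell2_adjoint_works[OF T] inner_basis)
  qed
  then show ?thesis by (simp add: less_eq_ell2.rep_eq zero_ell2.rep_eq)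
qed

section \<open>Positive factorizations of a positive diagonal operator\<close>

text \<open>
  The entries are non-negative because \<open>D\<close> is positive, and they are bounded by the norm of \<open>D\<close>, so
  their square roots define a bounded diagonal operator \<open>R\<close>. The operators \<open>R\<^sup>2\<close> and \<open>D\<close> agree on the
  basis, which is enough because both are bounded.
\<close>

lemma positive_diagonal_sqrt:
  fixes D :: "ell2 \<Rightarrow> ell2"
  assumes D: "bounded_linear D" and "diagonal_operator D" and pos: "positive_operator D"
  obtains R where "bounded_linear R" "\<And>x. 0 \<le> x \<Longrightarrow> 0 \<le> R x"
    "\<And>x y. inner (R x) y = inner x (R y)" "R \<circ> R = D"
proof -
  obtain d where d: "\<And>n. D (ell2_basis n) = d n *\<^sub>R ell2_basis n"
    using assms(2) unfolding diagonal_operator_def by blast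
  have d0: "0 \<le> d n" for n
  proof -
    have "0 \<le> D (ell2_basis n)"
      using pos basis_nonneg by (simp add: positive_operator_def)
    then have "0 \<le> ell2_nth (D (ell2_basis n)) n"
      by (simp add: less_eq_ell2.rep_eq zero_ell2.rep_eq)
    then show ?thesis by (simp add: d ell2_nth_scaleR ell2_nth_basis)
  qed
  obtain B where B: "\<And>x. norm (D x) \<le> norm x * B"
    using bounded_linear.bounded[OF D] by blast
  have "\<bar>sqrt (d n)\<bar> \<le> sqrt B" for n
    using B[of "ell2_basis n"] d0[of n] by (simp add: d norm_basis)
  then obtain R where R: "bounded_linear R"
    and nth_R: "\<And>x n. ell2_nth (R x) n = sqrt (d n) * ell2_nth x n"
    using ex_diagonal_operator[of "\<lambda>n. sqrt (d n)" "sqrt B"] by blast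
  show thesis
  proof
    show "bounded_linear R" by (rule R)
    show "0 \<le> R x" if "0 \<le> x" for x
      using that d0 by (simp add: less_eq_ell2.rep_eq zero_ell2.rep_eq nth_R)
    show "inner (R x) y = inner x (R y)" for x y
      by (simp add: ell2_inner_eq nth_R mult_ac)
    show "R \<circ> R = D"
    proof (rule bounded_linear_eq_on_basis)
      show "bounded_linear (R \<circ> R)"
        using bounded_linear_compose[OF R R] by (simp add: o_def)
      show "(R \<circ> R) (ell2_basis n) = D (ell2_basis n)" for n
        using d0 by (intro ell2_eqI) (simp add: nth_R d ell2_nth_scaleR ell2_nth_basis)
    qed (rule D)
  qed
qed

theorem proposition3p1:
  fixes D :: "ell2 \<Rightarrow> ell2"
  assumes "bounded_linear D" and "diagonal_operator D" and "positive_operator D"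
  shows "\<exists>X :: ell2 \<Rightarrow> L2_unit.
      bounded_linear X \<and> positive_operator X \<and> adjoint X \<circ> X = D \<and>
      (\<exists>Y :: L2_unit \<Rightarrow> L2_unit.
        positive_operator Y \<and> self_adjoint Y \<and> Y \<circ> Y = X \<circ> adjoint X)"
proof -
  obtain R where R: "bounded_linear R" and R_pos: "\<And>x. 0 \<le> x \<Longrightarrow> 0 \<le> R x"
    and R_sym: "\<And>x y. inner (R x) y = inner x (R y)" and RR: "R \<circ> R = D"
    using positive_diagonal_sqrt[OF assms] by blast
  define V where "V = adjoint step_embedding"
  note S = step_embedding_bounded_linear
  have V: "bounded_linear V"
    unfolding V_def by (rule ell2_adjoint_bounded_linear[OF S])
  have SV: "inner (step_embedding x) f = inner x (V f)" for x f
    unfolding V_def by (rule ell2_adjoint_works[OF S])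
  have V_pos: "0 \<le> V f" if "0 \<le> f" for f
    unfolding V_def by (rule adjoint_nonneg[OF S step_embedding_nonneg that])
  have VS: "V (step_embedding x) = x" for x
    unfolding V_def by (rule ell2_adjoint_isometry[OF S step_embedding_inner])
  define X where "X = step_embedding \<circ> R"
  define Y where "Y = step_embedding \<circ> R \<circ> V"
  have X: "bounded_linear X"
    unfolding X_def o_def by (rule bounded_linear_compose[OF S R])
  have Y: "bounded_linear Y"
    using bounded_linear_compose[OF X V] by (simp add: X_def Y_def o_def)
  have adj_X: "adjoint X = R \<circ> V"
    by (rule adjoint_unique) (simp add: X_def SV R_sym)
  have "inner (Y f) g = inner f (Y g)" for f g
    by (metis (no_types) Y_def comp_apply SV R_sym inner_commute)
  then have adj_Y: "adjoint Y = Y"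
    by (intro adjoint_unique) blast
  show ?thesis
  proof (intro exI conjI)
    show "bounded_linear X" by (rule X)
    show "positive_operator X"
      using bounded_linear.linear[OF X]
      by (simp add: positive_operator_def X_def R_pos step_embedding_nonneg)
    show "adjoint X \<circ> X = D"
      unfolding adj_X using RR by (simp add: X_def fun_eq_iff VS)
    show "positive_operator Y"
      using bounded_linear.linear[OF Y]
      by (simp add: positive_operator_def Y_def R_pos V_pos step_embedding_nonneg)
    show "self_adjoint Y"
      by (simp add: self_adjoint_def Y adj_Y)
    show "Y \<circ> Y = X \<circ> adjoint X"
      unfolding adj_X by (simp add: X_def Y_def fun_eq_iff VS)
  qed
qed

end
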